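(* There exists no nontrivial ideal in $k((t_{\bullet}))$ stable under the action of $\Gamma_{\bullet}$; that is, if $I\subset k((t_{\bullet}))$ is an ideal with $\gamma * I\subset I$ for all $\gamma\in\Gamma_{\bullet}$, then $I=0$ or $I=k((t_{\bullet}))$.
   Context: Let $K/F/\mathbb{Q}_p$ be finite field extensions with rings of integers $\mathcal{O}_F\subset\mathcal{O}_K$, let $q$ be the number of elements of the residue field of $F$, let $\pi$ be a uniformizer in $\mathcal{O}_F$, and let $k$ be the residue field of $\mathcal{O}_K$ (which is an $\mathcal{O}_F$-algebra). Put $\Gamma=\mathcal{O}_F^{\times}$. Consider the Lubin-Tate group for $F$ with respect to $\pi$; after fixing a coordinate $t$, let $\Phi(t)\in\mathcal{O}_F[[t]]$ be the corresponding Lubin-Tate formal power series (so $\Phi(t)\equiv \pi t$ modulo $t^2$, $\Phi(t)\equiv t^q$ modulo $\pi$, and $[\pi]_{\Phi}(t)=\Phi(t)$). For $\gamma\in\Gamma$ let $[\gamma]_{\Phi}(t)\in\mathcal{O}_F[[t]]$ be the power series describing the action of $\gamma$ in the Lubin-Tate group. Let $D$ be a finite set. Put $k[[t_{\bullet}]]=k[[t_d]]_{d\in D}$ (power series ring in the variables $t_d$, $d\in D$) and $k((t_{\bullet}))=k[[t_{\bullet}]][\prod_{d\in D}t_d^{-1}]$. For each $d\in D$ let $\Gamma_d$ be a copy of $\Gamma$, let $\Gamma_{\bullet}=\prod_{d\in D}\Gamma_d$, and for $\gamma\in\Gamma$ let $\gamma_d\in\Gamma_{\bullet}$ be the element whose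 $d$-component is $\gamma$ and whose other components are trivial. The group $\Gamma_{\bullet}$ acts on $k((t_{\bullet}))$ by $k$-algebra automorphisms, by substitution of power series, via $\gamma_d*t_d=[\gamma]_{\Phi}(t_d)$ and $\gamma_{d_1}*t_{d_2}=t_{d_2}$ for $d_1\neq d_2$. *)

theory Defs
  imports
    "HOL-Algebra.Algebra"
    "HOL-Algebra.Algebraic_Closure_Type"
    "HOL-Computational_Algebra.Computational_Algebra"
begin

unbundle fps_syntax

section \<open>\<open>p\<close>-adic fields\<close>

definition padic_abs :: "nat \<Rightarrow> rat \<Rightarrow> real" where
  "padic_abs p x =
     (if x = 0 then 0
      else of_nat p powi (int (multiplicity (int p) (snd (quotient_of x)))
                        - int (multiplicity (int p) (fst (quotient_of x)))))"

definition nonarch_abs :: "('a::field \<Rightarrow> real) \<Rightarrow> bool" where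
  "nonarch_abs v \<longleftrightarrow>
     (\<forall>x. 0 \<le> v x) \<and> (\<forall>x. v x = 0 \<longleftrightarrow> x = 0) \<and>
     (\<forall>x y. v (x * y) = v x * v y) \<and> (\<forall>x y. v (x + y) \<le> max (v x) (v y))"

text \<open>\<open>Q\<close>, with the restriction of \<open>v\<close>, is a completion of the rational numbers with respect
  to the \<open>p\<close>-adic absolute value.\<close>

definition is_padic_numbers :: "nat \<Rightarrow> ('a::field_char_0 \<Rightarrow> real) \<Rightarrow> 'a set \<Rightarrow> bool" where
  "is_padic_numbers p v Q \<longleftrightarrow>
     subfield Q ring_of_type_algebra \<and>
     (\<forall>r::rat. v (of_rat r) = padic_abs p r) \<and>
     (\<forall>x\<in>Q. \<forall>e>0. \<exists>r::rat. v (x - of_rat r) < e) \<and>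
     (\<forall>s::nat \<Rightarrow> 'a. (\<forall>n. s n \<in> Q) \<and> (\<forall>e>0. \<exists>N. \<forall>m\<ge>N. \<forall>n\<ge>N. v (s m - s n) < e)
        \<longrightarrow> (\<exists>x\<in>Q. (\<lambda>n. v (s n - x)) \<longlonglongrightarrow> 0))"

text \<open>A finite extension of the \<open>p\<close>-adic numbers carries exactly one absolute value \<open>v\<close> extending
  the \<open>p\<close>-adic one. The ring of integers of an intermediate field \<open>F\<close> is its closed unit ball.\<close>

definition valuation_ring :: "('a::field \<Rightarrow> real) \<Rightarrow> 'a set \<Rightarrow> 'a ring" where
  "valuation_ring v F = ring_of_type_algebra\<lparr>carrier := {x \<in> F. v x \<le> 1}\<rparr>"

definition max_ideal :: "('a::field \<Rightarrow> real) \<Rightarrow> 'a set \<Rightarrow> 'a set" where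
  "max_ideal v F = {x \<in> F. v x < 1}"

definition is_uniformizer :: "('a::field \<Rightarrow> real) \<Rightarrow> 'a set \<Rightarrow> 'a \<Rightarrow> bool" where
  "is_uniformizer v F \<pi> \<longleftrightarrow>
     \<pi> \<in> carrier (valuation_ring v F) \<and> max_ideal v F = PIdl\<^bsub>valuation_ring v F\<^esub> \<pi>"

definition residue_card :: "('a::field \<Rightarrow> real) \<Rightarrow> 'a set \<Rightarrow> nat" where
  "residue_card v F = card (carrier (valuation_ring v F Quot max_ideal v F))"

text \<open>The map \<open>\<rho>\<close> (only its values on the ring of integers matter) exhibits the field \<open>'k\<close> as the
  residue field.\<close>

definition is_residue_map :: "('a::field \<Rightarrow> real) \<Rightarrow> 'a set \<Rightarrow> ('a \<Rightarrow> 'k::field) \<Rightarrow> bool" where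
  "is_residue_map v F \<rho> \<longleftrightarrow>
     \<rho> \<in> ring_hom (valuation_ring v F) ring_of_type_algebra \<and>
     \<rho> ` carrier (valuation_ring v F) = UNIV \<and>
     a_kernel (valuation_ring v F) (ring_of_type_algebra :: 'k ring) \<rho> = max_ideal v F"


section \<open>Formal groups and Lubin-Tate groups\<close>

text \<open>A power series \<open>G(X,Y)\<close> in two variables is an element of \<open>'a fps fps\<close>; the coefficient
  of \<open>X\<^sup>i Y\<^sup>j\<close> is \<open>G $ i $ j\<close>. In the following, the sums are truncated
  versions of infinite ones: all terms left out vanish, because the series that are
  substituted (or that are raised to powers) have no constant term.\<close>

definition fps_over :: "'a set \<Rightarrow> 'a fps \<Rightarrow> bool" where
  "fps_over R f \<longleftrightarrow> (\<forall>n. f $ n \<in> R)"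

definition fps2_over :: "'a set \<Rightarrow> 'a fps fps \<Rightarrow> bool" where
  "fps2_over R G \<longleftrightarrow> (\<forall>i j. G $ i $ j \<in> R)"

text \<open>Associativity compares the coefficients of \<open>X\<^sup>i Y\<^sup>j Z\<^sup>k\<close>: on the left hand side that of
  \<open>G(G(X,Y),Z) = (\<Sum>r. \<Sum>s. G $ r $ s * G(X,Y)\<^sup>r * Z\<^sup>s)\<close>, on the right hand side that of
  \<open>G(X,G(Y,Z))\<close>.\<close>

definition formal_group_law :: "'a::comm_ring_1 set \<Rightarrow> 'a fps fps \<Rightarrow> bool" where
  "formal_group_law R G \<longleftrightarrow>
     fps2_over R G \<and>
     (\<forall>i. G $ i $ 0 = (if i = 1 then 1 else 0)) \<and>
     (\<forall>j. G $ 0 $ j = (if j = 1 then 1 else 0)) \<and>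
     (\<forall>i j k. (\<Sum>r\<le>i + j. G $ r $ k * (G ^ r) $ i $ j)
            = (\<Sum>s\<le>j + k. G $ i $ s * (G ^ s) $ j $ k)) \<and>
     (\<forall>i j. G $ i $ j = G $ j $ i)"

text \<open>The series \<open>G(f(t), g(t))\<close>.\<close>

definition fps2_subst :: "'a::comm_ring_1 fps fps \<Rightarrow> 'a fps \<Rightarrow> 'a fps \<Rightarrow> 'a fps" where
  "fps2_subst G f g = Abs_fps (\<lambda>n. \<Sum>r\<le>n. \<Sum>s\<le>n. G $ r $ s * (f ^ r * g ^ s) $ n)"

text \<open>Endomorphisms \<open>f\<close> of \<open>G\<close>: the two sums are the coefficients of \<open>X\<^sup>i Y\<^sup>j\<close> in
  \<open>f(G(X,Y))\<close> and in \<open>G(f(X),f(Y))\<close>.\<close>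

definition formal_group_endo :: "'a::comm_ring_1 set \<Rightarrow> 'a fps fps \<Rightarrow> 'a fps \<Rightarrow> bool" where
  "formal_group_endo R G f \<longleftrightarrow>
     fps_over R f \<and> f $ 0 = 0 \<and>
     (\<forall>i j. (\<Sum>n\<le>i + j. f $ n * (G ^ n) $ i $ j)
          = (\<Sum>r\<le>i. \<Sum>s\<le>j. G $ r $ s * (f ^ r) $ i * (f ^ s) $ j))"

text \<open>A formal \<open>R\<close>-module: a formal group law \<open>G\<close> over \<open>R\<close> with a ring homomorphism
  \<open>a \<mapsto> br a\<close> into its endomorphism ring such that \<open>br a\<close> is \<open>a t\<close> modulo \<open>t\<^sup>2\<close>.\<close>

definition formal_module :: "'a::comm_ring_1 set \<Rightarrow> 'a fps fps \<Rightarrow> ('a \<Rightarrow> 'a fps) \<Rightarrow> bool" where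
  "formal_module R G br \<longleftrightarrow>
     formal_group_law R G \<and>
     (\<forall>a\<in>R. formal_group_endo R G (br a) \<and> br a $ 1 = a) \<and>
     br 1 = fps_X \<and>
     (\<forall>a\<in>R. \<forall>b\<in>R. br (a + b) = fps2_subst G (br a) (br b)) \<and>
     (\<forall>a\<in>R. \<forall>b\<in>R. br (a * b) = br a oo br b)"

definition lubin_tate_series :: "'a::comm_ring_1 set \<Rightarrow> 'a \<Rightarrow> nat \<Rightarrow> 'a fps \<Rightarrow> bool" where
  "lubin_tate_series R \<pi> q \<Phi> \<longleftrightarrow>
     fps_over R \<Phi> \<and> \<Phi> $ 0 = 0 \<and> \<Phi> $ 1 = \<pi> \<and>
     (\<forall>n. \<exists>c\<in>R. \<Phi> $ n - (fps_X ^ q) $ n = \<pi> * c)"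

definition lubin_tate_group ::
  "'a::comm_ring_1 set \<Rightarrow> 'a \<Rightarrow> nat \<Rightarrow> 'a fps \<Rightarrow> 'a fps fps \<Rightarrow> ('a \<Rightarrow> 'a fps) \<Rightarrow> bool" where
  "lubin_tate_group R \<pi> q \<Phi> G br \<longleftrightarrow>
     lubin_tate_series R \<pi> q \<Phi> \<and> formal_module R G br \<and> br \<pi> = \<Phi>"


section \<open>Laurent series in several variables\<close>

text \<open>Series in the variables \<open>t\<^sub>d\<close>, \<open>d \<in> D\<close>, are given by their coefficient functions. An exponent
  vector is a function \<open>'d \<Rightarrow> int\<close> that is zero outside \<open>D\<close>.\<close>

definition mv_power_series :: "'d set \<Rightarrow> (('d \<Rightarrow> int) \<Rightarrow> 'k::field) set" where
  "mv_power_series D = {f. \<forall>n. f n \<noteq> 0 \<longrightarrow> (\<forall>d\<in>D. 0 \<le> n d) \<and> (\<forall>d. d \<notin> D \<longrightarrow> n d = 0)}"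

text \<open>Multiplication by the \<open>N\<close>-th power of \<open>\<Prod>d\<in>D. t\<^sub>d\<close>.\<close>

definition mv_shift :: "'d set \<Rightarrow> nat \<Rightarrow> (('d \<Rightarrow> int) \<Rightarrow> 'k::field) \<Rightarrow> (('d \<Rightarrow> int) \<Rightarrow> 'k)" where
  "mv_shift D N f = (\<lambda>n. f (\<lambda>d. if d \<in> D then n d - int N else n d))"

definition mv_laurent_series :: "'d set \<Rightarrow> (('d \<Rightarrow> int) \<Rightarrow> 'k::field) set" where
  "mv_laurent_series D = {f. \<exists>N. mv_shift D N f \<in> mv_power_series D}"

text \<open>The index set of the sum in the product is finite for Laurent series in finitely many
  variables.\<close>

definition mv_mult ::
  "(('d \<Rightarrow> int) \<Rightarrow> 'k::field) \<Rightarrow> (('d \<Rightarrow> int) \<Rightarrow> 'k) \<Rightarrow> (('d \<Rightarrow> int) \<Rightarrow> 'k)" where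
  "mv_mult f g = (\<lambda>n. \<Sum>a | f a \<noteq> 0 \<and> g (\<lambda>d. n d - a d) \<noteq> 0. f a * g (\<lambda>d. n d - a d))"

definition mv_laurent_ring :: "'d set \<Rightarrow> (('d \<Rightarrow> int) \<Rightarrow> 'k::field) ring" where
  "mv_laurent_ring D =
     \<lparr>carrier = mv_laurent_series D,
      monoid.mult = mv_mult,
      one = (\<lambda>n. if n = (\<lambda>_. 0) then 1 else 0),
      ring.zero = (\<lambda>_. 0),
      add = (\<lambda>f g n. f n + g n)\<rparr>"

text \<open>Substitution of \<open>u d\<close> for \<open>t\<^sub>d\<close>, for one-variable series \<open>u d\<close> in \<open>t\<^sub>d\<close> with nonzero linear term
  and no constant term:
  a series \<open>f\<close> is sent to \<open>\<Sum>n. f n * (\<Prod>d\<in>D. u d (t\<^sub>d) powi n d)\<close>. Since the order of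
  \<open>u d powi n d\<close> is \<open>n d\<close>, only the indices \<open>n\<close> with \<open>n \<le> m\<close> (finitely many, if \<open>f\<close> is a
  Laurent series) contribute to the coefficient at \<open>m\<close>.\<close>

definition mv_subst ::
  "'d set \<Rightarrow> ('d \<Rightarrow> 'k::field fps) \<Rightarrow> (('d \<Rightarrow> int) \<Rightarrow> 'k) \<Rightarrow> (('d \<Rightarrow> int) \<Rightarrow> 'k)" where
  "mv_subst D u f = (\<lambda>m.
     if \<forall>d. d \<notin> D \<longrightarrow> m d = 0
     then \<Sum>n | f n \<noteq> 0 \<and> (\<forall>d\<in>D. n d \<le> m d).
            f n * (\<Prod>d\<in>D. fls_nth (fps_to_fls (u d) powi n d) (m d))
     else 0)"

text \<open>The action of an element \<open>\<gamma>\<close> of \<open>\<Gamma>\<^sub>\<bullet>\<close>, where \<open>\<rho>\<close> is the reduction to the residue field and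
  \<open>br\<close> the scalar multiplication of the Lubin-Tate group.\<close>

definition lt_action ::
  "('a \<Rightarrow> 'k::field) \<Rightarrow> ('a \<Rightarrow> 'a fps) \<Rightarrow> 'd set \<Rightarrow> ('d \<Rightarrow> 'a) \<Rightarrow>
   (('d \<Rightarrow> int) \<Rightarrow> 'k) \<Rightarrow> (('d \<Rightarrow> int) \<Rightarrow> 'k)" where
  "lt_action \<rho> br D \<gamma> = mv_subst D (\<lambda>d. Abs_fps (\<lambda>n. \<rho> (br (\<gamma> d) $ n)))"

end

theory Submission
  imports Defs
begin

text \<open>The units \<open>1 + \<pi>\<^sup>m\<close>, \<open>m \<ge> 1\<close>, act on \<open>k((t))\<close> by substitutions \<open>t \<mapsto> u\<^sub>m\<close> with pairwise
  distinct \<open>u\<^sub>m = t + t^(q^m) + \<dots>\<close>. For \<open>a + 1\<close> distinct series \<open>x\<^sub>j\<close> without constant term the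
  divided difference \<open>h \<mapsto> \<Sum>j. h(x\<^sub>j) / (\<Prod>l\<noteq>j. x\<^sub>j - x\<^sub>l)\<close> annihilates \<open>t\<^sup>i\<close> for \<open>i < a\<close>, sends
  \<open>t\<^sup>a\<close> to \<open>1\<close>, and sends \<open>t\<^sup>i\<close> for \<open>i > a\<close> to the complete homogeneous symmetric polynomial of
  degree \<open>i - a\<close> in the \<open>x\<^sub>j\<close>, which has no constant term. Applied in the variable \<open>t\<^sub>d\<close>, it maps
  a power series \<open>\<Sum>i. c\<^sub>i t\<^sub>d\<^sup>i\<close> of a stable ideal to an element \<open>c\<^sub>a + O(t\<^sub>d)\<close> of the ideal.
  Start with a nonzero coefficient of a power series in the ideal and do this for one variable after
  the other: the result is a power series in the ideal with nonzero constant coefficient, a unit.\<close>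

section \<open>Divided differences of power series\<close>

text \<open>The Lagrange weights: summing them against \<open>h (x j)\<close> gives the divided
  difference of \<open>h\<close> at the nodes \<open>x j\<close>.\<close>

definition dd_weight :: "('i \<Rightarrow> 'b::field) \<Rightarrow> 'i set \<Rightarrow> 'i \<Rightarrow> 'b" where
  "dd_weight x J j = (\<Prod>l\<in>J - {j}. inverse (x j - x l))"

text \<open>The factor \<open>x j - x z\<close> kills the term \<open>j = z\<close> and cancels the
  factor \<open>l = z\<close> in every other weight. Hence multiplying the argument of a divided
  difference by (t - x_z) removes the node x_z.\<close>

lemma sum_dd_weight_remove:
  assumes "finite J" "inj_on x J" "z \<in> J"
  shows "(\<Sum>j\<in>J. dd_weight x J j * (x j - x z) * g j)
       = (\<Sum>j\<in>J - {z}. dd_weight x (J - {z}) j * g j)"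
proof -
  have "dd_weight x J j * (x j - x z) = dd_weight x (J - {z}) j" if "j \<in> J - {z}" for j
  proof -
    have "J - {j} = insert z (J - {z} - {j})" using that assms by auto
    moreover have "x j - x z \<noteq> 0"
      using that assms by (auto simp: inj_on_def)
    ultimately show ?thesis using assms(1) by (simp add: dd_weight_def)
  qed
  then have "(\<Sum>j\<in>J - {z}. dd_weight x J j * (x j - x z) * g j)
       = (\<Sum>j\<in>J - {z}. dd_weight x (J - {z}) j * g j)" by (intro sum.cong) auto
  then show ?thesis using assms by (simp add: sum.remove[of J z])
qed

lemma sum_dd_weight:
  assumes "finite J" "inj_on x J"
  shows "(\<Sum>j\<in>J. dd_weight x J j) = (if card J = 1 then 1 else 0)"
  using assms
proof (induction "card J" arbitrary: J rule: less_induct)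
  case less
  consider "J = {}" | z where "J = {z}" | z z' where "z \<in> J" "z' \<in> J" "z \<noteq> z'" by blast
  then show ?case
  proof cases
    case 3
    have ih: "(\<Sum>j\<in>J - {y}. dd_weight x (J - {y}) j) = (if card J - 1 = 1 then 1 else 0)"
      if "y \<in> J" for y
    proof -
      have "card (J - {y}) < card J" using that less.prems by (meson card_Diff1_less)
      moreover have "inj_on x (J - {y})" using less.prems(2) by (rule inj_on_diff)
      ultimately show ?thesis using less.hyps[of "J - {y}"] less.prems that by simp
    qed
    \<comment> \<open>Since x_z' - x_z = (x_j - x_z) - (x_j - x_z'), the sum becomes a difference of
      two sums with one node fewer. By induction both depend only on the cardinality, so they
      cancel.\<close>
    have "(\<Sum>j\<in>J. dd_weight x J j) * (x z' - x z)
        = (\<Sum>j\<in>J. dd_weight x J j * (x j - x z) * 1)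
          - (\<Sum>j\<in>J. dd_weight x J j * (x j - x z') * 1)"
      unfolding sum_distrib_right sum_subtractf[symmetric]
      by (intro sum.cong) (auto simp: algebra_simps)
    also have "\<dots> = 0"
      using ih[OF 3(1)] ih[OF 3(2)] sum_dd_weight_remove[OF less.prems 3(1), of "\<lambda>_. 1"]
        sum_dd_weight_remove[OF less.prems 3(2), of "\<lambda>_. 1"] by simp
    finally have "(\<Sum>j\<in>J. dd_weight x J j) = 0"
      using 3 less.prems by (auto simp: inj_on_def)
    moreover have "card J \<noteq> 1" using 3 by (metis card_1_singletonE singletonD)
    ultimately show ?thesis by simp
  qed (auto simp: dd_weight_def)
qed

text \<open>Regularity at t = 0 together with the value there. The weights have poles in general, so
  this can only be claimed for whole divided differences, not term by term.\<close>

definition fls_has_const :: "'k::field fls \<Rightarrow> 'k \<Rightarrow> bool" where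
  "fls_has_const F c \<longleftrightarrow> (\<exists>s. F = fps_to_fls s \<and> s $ 0 = c)"

lemma fls_has_const_add:
  "fls_has_const F a \<Longrightarrow> fls_has_const H b \<Longrightarrow> fls_has_const (F + H) (a + b)"
  unfolding fls_has_const_def by (metis fps_to_fls_plus fps_add_nth)

lemma fls_has_const_mult:
  "fls_has_const F a \<Longrightarrow> fls_has_const H b \<Longrightarrow> fls_has_const (F * H) (a * b)"
  unfolding fls_has_const_def by (metis fls_times_fps_to_fls fps_mult_nth_0)

lemma fls_has_const_sum:
  assumes "\<And>j. j \<in> J \<Longrightarrow> fls_has_const (F j) (c j)"
  shows "fls_has_const (\<Sum>j\<in>J. F j) (\<Sum>j\<in>J. c j)"
  using assms
proof (induction J rule: infinite_finite_induct)
  case (insert j J)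
  then show ?case by (simp add: fls_has_const_add)
qed (auto simp: fls_has_const_def intro!: exI[of _ 0])

lemma fls_has_const_fps_to_fls: "fls_has_const (fps_to_fls s) (s $ 0)"
  by (auto simp: fls_has_const_def)

text \<open>Induction on \<open>i\<close> through t^(i+1) = x_z t^i + (t - x_z) t^i for a node x_z.
  The first part has constant term 0 because x_z has; the second is the divided difference of t^i
  with the node x_z removed.\<close>

lemma dd_monomial:
  assumes "finite J" "inj_on u J" "\<And>j. j \<in> J \<Longrightarrow> u j $ 0 = 0"
  shows "fls_has_const (\<Sum>j\<in>J. dd_weight (\<lambda>j. fps_to_fls (u j)) J j * fps_to_fls (u j) ^ i)
           (if card J = Suc i then 1 else 0)"
  using assms
proof (induction i arbitrary: J)
  case 0
  then have "inj_on (\<lambda>j. fps_to_fls (u j)) J" by (auto simp: inj_on_def)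
  then show ?case using 0
    by (auto simp: sum_dd_weight fls_has_const_def intro: exI[of _ 1] exI[of _ 0])
next
  case (Suc i)
  let ?x = "\<lambda>j. fps_to_fls (u j)"
  show ?case
  proof (cases "J = {}")
    case True
    then show ?thesis by (auto simp: fls_has_const_def intro: exI[of _ 0])
  next
    case False
    then obtain z where z: "z \<in> J" by blast
    have inj: "inj_on ?x J" using Suc.prems by (auto simp: inj_on_def)
    have "(\<Sum>j\<in>J. dd_weight ?x J j * ?x j ^ Suc i)
        = ?x z * (\<Sum>j\<in>J. dd_weight ?x J j * ?x j ^ i)
          + (\<Sum>j\<in>J. dd_weight ?x J j * (?x j - ?x z) * ?x j ^ i)"
      by (simp add: sum_distrib_left algebra_simps sum_subtractf)
    also have "\<dots> = ?x z * (\<Sum>j\<in>J. dd_weight ?x J j * ?x j ^ i)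
        + (\<Sum>j\<in>J - {z}. dd_weight ?x (J - {z}) j * ?x j ^ i)"
      using sum_dd_weight_remove[OF Suc.prems(1) inj z] by simp
    finally have eq: "(\<Sum>j\<in>J. dd_weight ?x J j * ?x j ^ Suc i) = \<dots>" .
    have "fls_has_const (?x z * (\<Sum>j\<in>J. dd_weight ?x J j * ?x j ^ i)
            + (\<Sum>j\<in>J - {z}. dd_weight ?x (J - {z}) j * ?x j ^ i))
          (u z $ 0 * (if card J = Suc i then 1 else 0)
            + (if card (J - {z}) = Suc i then 1 else 0))"
      using Suc.prems
      by (intro fls_has_const_add fls_has_const_mult fls_has_const_fps_to_fls Suc.IH)
        (auto intro: inj_on_diff)
    moreover have "card (J - {z}) = Suc i \<longleftrightarrow> card J = Suc (Suc i)"
      using z Suc.prems(1) by (auto dest: card_Suc_Diff1)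
    ultimately show ?thesis
      unfolding eq using z Suc.prems(3) by (simp del: card_Diff_insert)
  qed
qed

text \<open>The order of y^n r is at least n, which finally outweighs the pole of \<open>w\<close>.
  The bound on n does not depend on \<open>r\<close>, which allows \<open>r\<close> to be chosen
  after n.\<close>

lemma eventually_fls_times_power:
  fixes w :: "'k::field fls"
  assumes "y $ 0 = 0"
  shows "\<forall>\<^sub>F n in sequentially. \<forall>r. fls_has_const (w * fps_to_fls (y ^ n * r)) 0"
  unfolding eventually_sequentially
proof (intro exI allI impI)
  fix n r
  \<comment> \<open>The summand 1 pushes the order of the product to at least 1, so that the
    constant term vanishes too.\<close>
  assume n: "nat (1 - fls_subdegree w) \<le> n"
  let ?F = "w * fps_to_fls (y ^ n * r)"
  have nth0: "?F $$ i = 0" if "i \<le> 0" for i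
  proof (cases "y ^ n * r = 0")
    case False
    then have "subdegree (y ^ n * r) = n * subdegree y + subdegree r" by simp
    moreover have "n * 1 \<le> n * subdegree y"
    proof (cases "n = 0")
      case n: False
      then have "y \<noteq> 0" using False by auto
      then have "subdegree y \<noteq> 0" using assms by (auto simp: subdegree_eq_0_iff)
      then show ?thesis by (intro mult_left_mono) auto
    qed simp
    ultimately have "subdegree (y ^ n * r) \<ge> n" by linarith
    then show ?thesis using n that
      by (intro fls_times_nth_eq0) (simp add: fls_subdegree_fls_to_fps)
  qed (simp only: fps_zero_to_fls mult_zero_right fls_zero_nth)
  have "fls_subdegree ?F \<ge> 0"
  proof (cases "?F = 0")
    case False
    then show ?thesis by (rule fls_subdegree_geI) (simp only: nth0 less_imp_le)
  qed (simp only: fls_zero_subdegree)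
  then have "?F = fps_to_fls (fls_regpart ?F)" by simp
  moreover have "fls_regpart ?F $ 0 = 0" using nth0[of 0] by simp
  ultimately show "fls_has_const ?F 0" unfolding fls_has_const_def by blast
qed

lemma fps_to_fls_sum: "fps_to_fls (sum f A) = (\<Sum>i\<in>A. fps_to_fls (f i))"
  by (induction A rule: infinite_finite_induct) auto

text \<open>Extends \<open>dd_monomial\<close> from monomials to power series. Write h as a
  polynomial of degree below n plus t^n r: for large n the tail adds nothing to the constant term,
  and among the monomials only t^a does.\<close>

lemma dd_compose:
  fixes u :: "'i \<Rightarrow> 'k::field fps"
  assumes "finite J" "inj_on u J" "\<And>j. j \<in> J \<Longrightarrow> u j $ 0 = 0" "card J = Suc a"
  shows "fls_has_const
    (\<Sum>j\<in>J. dd_weight (\<lambda>j. fps_to_fls (u j)) J j * fps_to_fls (h oo u j)) (h $ a)"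
proof -
  let ?w = "dd_weight (\<lambda>j. fps_to_fls (u j)) J"
  have "\<forall>\<^sub>F n in sequentially. \<forall>j\<in>J. \<forall>r. fls_has_const (?w j * fps_to_fls (u j ^ n * r)) 0"
    using assms by (intro eventually_ball_finite ballI eventually_fls_times_power) auto
  \<comment> \<open>With a < n the monomial t^a belongs to the polynomial part and not to the
    tail.\<close>
  then have "\<forall>\<^sub>F n in sequentially. a < n \<and>
      (\<forall>j\<in>J. \<forall>r. fls_has_const (?w j * fps_to_fls (u j ^ n * r)) 0)"
    using eventually_gt_at_top by (rule eventually_conj[rotated])
  then obtain n where n: "a < n"
    "\<And>j r. j \<in> J \<Longrightarrow> fls_has_const (?w j * fps_to_fls (u j ^ n * r)) 0"
    using eventually_happens'[OF sequentially_bot] by blast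
  define r where "r = fps_shift n h"
  have h: "h = (\<Sum>i<n. fps_const (h $ i) * fps_X ^ i) + fps_X ^ n * r"
    by (rule fps_ext) (auto simp: r_def fps_sum_nth fps_X_power_mult_nth if_distrib cong: if_cong)
  have comp: "h oo u j = (\<Sum>i<n. fps_const (h $ i) * u j ^ i) + u j ^ n * (r oo u j)"
    if "j \<in> J" for j
    by (subst h) (use assms(3)[OF that] in
        \<open>simp add: fps_compose_add_distrib fps_compose_sum_distrib fps_compose_mult_distrib
          fps_compose_power[symmetric]\<close>)
  have "(\<Sum>j\<in>J. ?w j * fps_to_fls (h oo u j))
     = (\<Sum>j\<in>J. (\<Sum>i<n. fps_to_fls (fps_const (h $ i)) * (?w j * fps_to_fls (u j) ^ i))
         + ?w j * fps_to_fls (u j ^ n * (r oo u j)))"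
    by (intro sum.cong refl)
       (simp add: comp fps_to_fls_sum fls_times_fps_to_fls fps_to_fls_power algebra_simps
         sum_distrib_left)
  also have "\<dots> = (\<Sum>i<n. fps_to_fls (fps_const (h $ i)) * (\<Sum>j\<in>J. ?w j * fps_to_fls (u j) ^ i))
         + (\<Sum>j\<in>J. ?w j * fps_to_fls (u j ^ n * (r oo u j)))"
    by (simp add: sum.distrib sum_distrib_left sum.swap[of _ J])
  finally have eq: "(\<Sum>j\<in>J. ?w j * fps_to_fls (h oo u j)) = \<dots>" .
  have "fls_has_const (\<Sum>j\<in>J. ?w j * fps_to_fls (h oo u j))
     ((\<Sum>i<n. fps_const (h $ i) $ 0 * (if card J = Suc i then 1 else 0)) + (\<Sum>j\<in>J. 0))"
    unfolding eq using assms n(2)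
    by (intro fls_has_const_add fls_has_const_sum fls_has_const_mult fls_has_const_fps_to_fls
        dd_monomial) auto
  then show ?thesis using n(1) assms(4) by (simp add: if_distrib cong: if_cong)
qed

section \<open>Reduction of the Lubin-Tate action\<close>

definition fps_map :: "('a \<Rightarrow> 'b) \<Rightarrow> 'a fps \<Rightarrow> 'b fps" where
  "fps_map \<rho> f = Abs_fps (\<lambda>n. \<rho> (f $ n))"

lemma fps_map_nth [simp]: "fps_map \<rho> f $ n = \<rho> (f $ n)"
  by (simp add: fps_map_def)

text \<open>The laws for \<open>\<rho>\<close> are required on \<open>R\<close> only, because a
  residue map is arbitrary outside the ring of integers.\<close>

locale subring_hom =
  fixes R :: "'a::comm_ring_1 set" and \<rho> :: "'a \<Rightarrow> 'k::field"
  assumes zero_mem [simp]: "0 \<in> R"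
    and one_mem [simp]: "1 \<in> R"
    and add_mem [simp]: "\<And>x y. x \<in> R \<Longrightarrow> y \<in> R \<Longrightarrow> x + y \<in> R"
    and mult_mem [simp]: "\<And>x y. x \<in> R \<Longrightarrow> y \<in> R \<Longrightarrow> x * y \<in> R"
    and hom_one [simp]: "\<rho> 1 = 1"
    and hom_add [simp]: "\<And>x y. x \<in> R \<Longrightarrow> y \<in> R \<Longrightarrow> \<rho> (x + y) = \<rho> x + \<rho> y"
    and hom_mult [simp]: "\<And>x y. x \<in> R \<Longrightarrow> y \<in> R \<Longrightarrow> \<rho> (x * y) = \<rho> x * \<rho> y"
begin

lemma hom_zero [simp]: "\<rho> 0 = 0"
  using hom_add[OF zero_mem zero_mem] by (simp only: add_0_left add_cancel_right_right)

lemma power_mem [simp]: "x \<in> R \<Longrightarrow> x ^ n \<in> R"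
  by (induction n) auto

lemma sum_mem: "(\<And>i. i \<in> A \<Longrightarrow> f i \<in> R) \<Longrightarrow> sum f A \<in> R"
  by (induction A rule: infinite_finite_induct) auto

lemma hom_sum: "(\<And>i. i \<in> A \<Longrightarrow> f i \<in> R) \<Longrightarrow> \<rho> (sum f A) = (\<Sum>i\<in>A. \<rho> (f i))"
  by (induction A rule: infinite_finite_induct) (auto simp: sum_mem)

lemma fps_over_mult: "fps_over R f \<Longrightarrow> fps_over R g \<Longrightarrow> fps_over R (f * g)"
  by (auto simp: fps_over_def fps_mult_nth intro!: sum_mem)

lemma fps_over_X_power: "fps_over R (fps_X ^ n)"
  by (auto simp: fps_over_def fps_X_power_nth)

lemma fps_over_power: "fps_over R f \<Longrightarrow> fps_over R (f ^ n)"
  by (induction n) (use fps_over_X_power[of 0] in \<open>auto simp: fps_over_mult\<close>)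

lemma fps_map_mult:
  "fps_over R f \<Longrightarrow> fps_over R g \<Longrightarrow> fps_map \<rho> (f * g) = fps_map \<rho> f * fps_map \<rho> g"
  by (rule fps_ext) (auto simp: fps_over_def fps_mult_nth hom_sum)

lemma fps_map_X_power [simp]: "fps_map \<rho> (fps_X ^ n) = fps_X ^ n"
  by (rule fps_ext) (auto simp: fps_X_power_nth)

lemma fps_map_X [simp]: "fps_map \<rho> fps_X = fps_X"
  using fps_map_X_power[of 1] by simp

lemma fps_map_power: "fps_over R f \<Longrightarrow> fps_map \<rho> (f ^ n) = fps_map \<rho> f ^ n"
  by (induction n) (use fps_map_X_power[of 0] in \<open>auto simp: fps_map_mult fps_over_power\<close>)

lemma fps_map_compose:
  assumes "fps_over R f" "fps_over R g"
  shows "fps_map \<rho> (f oo g) = fps_map \<rho> f oo fps_map \<rho> g"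
proof (rule fps_ext)
  fix n
  have "f $ i \<in> R" "(g ^ i) $ n \<in> R" for i
    using assms fps_over_power by (auto simp: fps_over_def)
  then show "fps_map \<rho> (f oo g) $ n = (fps_map \<rho> f oo fps_map \<rho> g) $ n"
    by (simp add: fps_compose_nth hom_sum flip: fps_map_power[OF assms(2)])
qed

lemma fps_map_fps2_subst_nth:
  assumes "fps2_over R G" "fps_over R f" "fps_over R g"
  shows "fps_map \<rho> (fps2_subst G f g) $ n
    = (\<Sum>r\<le>n. \<Sum>s\<le>n. \<rho> (G $ r $ s) * (fps_map \<rho> f ^ r * fps_map \<rho> g ^ s) $ n)"
proof -
  have "G $ r $ s \<in> R" "(f ^ r * g ^ s) $ n \<in> R" for r s
    using assms fps_over_mult[OF fps_over_power[of f r] fps_over_power[of g s]]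
    by (auto simp: fps2_over_def fps_over_def)
  then show ?thesis using assms
    by (simp add: fps2_subst_def hom_sum sum_mem fps_over_power
        flip: fps_map_power fps_map_mult)
qed

end

text \<open>Absolute values are forgotten here: all that remains of the residue map is that it is a
  homomorphism on \<open>R\<close> killing \<open>\<pi>\<close>.\<close>

locale lubin_tate_reduction = subring_hom R \<rho>
  for R :: "'a::comm_ring_1 set" and \<rho> :: "'a \<Rightarrow> 'k::field" +
  fixes \<pi> :: 'a and q :: nat and \<Phi> :: "'a fps" and G :: "'a fps fps" and br :: "'a \<Rightarrow> 'a fps"
  assumes pi_mem [simp]: "\<pi> \<in> R"
    and hom_pi [simp]: "\<rho> \<pi> = 0"
    and lt: "lubin_tate_group R \<pi> q \<Phi> G br"
begin

lemma br_over: "a \<in> R \<Longrightarrow> fps_over R (br a)"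
  using lt by (simp add: lubin_tate_group_def formal_module_def formal_group_endo_def)

lemma br_nth_0: "a \<in> R \<Longrightarrow> br a $ 0 = 0"
  using lt by (simp add: lubin_tate_group_def formal_module_def formal_group_endo_def)

lemma br_one: "br 1 = fps_X"
  using lt by (simp add: lubin_tate_group_def formal_module_def)

lemma br_add: "a \<in> R \<Longrightarrow> b \<in> R \<Longrightarrow> br (a + b) = fps2_subst G (br a) (br b)"
  using lt by (simp add: lubin_tate_group_def formal_module_def)

lemma br_mult: "a \<in> R \<Longrightarrow> b \<in> R \<Longrightarrow> br (a * b) = br a oo br b"
  using lt by (simp add: lubin_tate_group_def formal_module_def)

lemma fps_map_br_pi: "fps_map \<rho> (br \<pi>) = fps_X ^ q"
proof (rule fps_ext)
  fix n
  have "\<exists>c\<in>R. br \<pi> $ n - (fps_X ^ q) $ n = \<pi> * c"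
    using lt by (simp add: lubin_tate_group_def lubin_tate_series_def)
  then obtain c where "c \<in> R" "br \<pi> $ n = (fps_X ^ q) $ n + \<pi> * c"
    by (auto simp: algebra_simps)
  then show "fps_map \<rho> (br \<pi>) $ n = (fps_X ^ q) $ n"
    by (simp add: fps_X_power_nth)
qed

text \<open>The reduction of \<open>\<Phi>\<close> also rules out \<open>q = 0\<close>, the junk value of \<open>card\<close> for an infinite
  residue field.\<close>

lemma q_ge_2: "q \<ge> 2"
proof -
  have "br \<pi> $ 0 = 0" "br \<pi> $ 1 = \<pi>"
    using lt by (simp_all add: lubin_tate_group_def lubin_tate_series_def)
  then have "(fps_X ^ q) $ 0 = (0::'k)" "(fps_X ^ q) $ 1 = (0::'k)"
    by (simp_all flip: fps_map_br_pi)
  then have "q \<noteq> 0" "q \<noteq> 1" by (auto simp: fps_X_power_nth split: if_splits)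
  then show ?thesis by simp
qed

lemma q_power_gt_1: "q ^ Suc m > 1"
  using q_ge_2 by (metis One_nat_def Suc_1 Suc_le_lessD one_less_power zero_less_Suc)

text \<open>Products of scalars act by composition, so the reduction is an iterate of t^q.\<close>

lemma fps_map_br_pi_power: "fps_map \<rho> (br (\<pi> ^ Suc m)) = fps_X ^ (q ^ Suc m)"
proof (induction m)
  case 0
  then show ?case by (simp add: fps_map_br_pi)
next
  case (Suc m)
  have "fps_map \<rho> (br (\<pi> ^ Suc (Suc m))) = fps_X ^ q oo fps_X ^ (q ^ Suc m)"
    using br_mult[of \<pi> "\<pi> ^ Suc m"] Suc br_over
    by (simp add: fps_map_compose fps_map_br_pi)
  also have "\<dots> = (fps_X oo fps_X ^ (q ^ Suc m)) ^ q"
    using q_power_gt_1[of m] q_ge_2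
    by (subst fps_compose_power) (auto simp: fps_X_power_nth)
  also have "\<dots> = fps_X ^ (q ^ Suc (Suc m))"
    using q_power_gt_1[of m]
    by (subst fps_X_fps_compose_startby0)
      (simp_all only: fps_X_power_nth flip: power_mult power_Suc2, use q_ge_2 in simp)
  finally show ?case .
qed

text \<open>With Q = q^(m+1), the series of 1 + \<pi>^(m+1) reduces to G(t, t^Q), with the
  coefficients of G reduced. As G(X,Y) = X + Y plus multiples of XY, this is t + t^Q modulo
  t^(Q+1).\<close>

lemma fps_map_br_one_plus_pi_power_nth:
  assumes "n \<le> q ^ Suc m"
  shows "fps_map \<rho> (br (1 + \<pi> ^ Suc m)) $ n
    = (if n = 1 then 1 else 0) + (if n = q ^ Suc m then 1 else 0)"
proof -
  define Q where "Q = q ^ Suc m"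
  have Q: "Q > 1" "n \<le> Q" using q_power_gt_1[of m] assms by (simp_all add: Q_def)
  have G: "fps2_over R G" "G $ n $ 0 = (if n = 1 then 1 else 0)" "G $ 0 $ 1 = 1"
    using lt by (simp_all add: lubin_tate_group_def formal_module_def formal_group_law_def)
  have "fps_map \<rho> (br (1 + \<pi> ^ Suc m)) $ n
      = (\<Sum>r\<le>n. \<Sum>s\<le>n. \<rho> (G $ r $ s) * (fps_X ^ r * (fps_X ^ Q) ^ s) $ n)"
    using br_over[of "\<pi> ^ Suc m"] fps_over_X_power[of 1] G(1)
    by (subst br_add) (simp_all only: fps_map_fps2_subst_nth br_one fps_map_br_pi_power Q_def
        one_mem pi_mem power_mem fps_map_X power_one_right)
  also have "\<dots> = (\<Sum>r\<le>n. \<Sum>s\<le>n. (if s = 0 then if r = n then \<rho> (G $ n $ 0) else 0 else 0)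
      + (if s = 1 then if r = 0 then if n = Q then 1 else 0 else 0 else 0))"
  proof (intro sum.cong refl)
    fix r s
    have "(fps_X ^ r * (fps_X ^ Q) ^ s) $ n = (if n = r + Q * s then 1 else 0 :: 'k)"
      by (simp add: fps_X_power_nth flip: power_mult power_add)
    \<comment> \<open>The monomial X^r Y^s of G contributes in degree r + Q s. Below or at degree Q
      this leaves only the pure powers of X and the term Y.\<close>
    moreover have "n = r + Q * s \<longleftrightarrow> s = 0 \<and> r = n \<or> s = 1 \<and> r = 0 \<and> n = Q"
    proof (cases "s \<ge> 2")
      case True
      then have "Q * 2 \<le> Q * s" by (rule mult_le_mono2)
      then have "n \<noteq> r + Q * s" using Q by linarith
      then show ?thesis using True by simp
    next
      case False
      then have "s = 0 \<or> s = 1" by linarith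
      then show ?thesis using Q by auto
    qed
    ultimately show "\<rho> (G $ r $ s) * (fps_X ^ r * (fps_X ^ Q) ^ s) $ n
      = (if s = 0 then if r = n then \<rho> (G $ n $ 0) else 0 else 0)
      + (if s = 1 then if r = 0 then if n = Q then 1 else 0 else 0 else 0)"
      using G by auto
  qed
  also have "\<dots> = \<rho> (G $ n $ 0) + (if n = Q then 1 else 0)"
    using Q by (simp add: sum.distrib cong: if_cong)
  finally show ?thesis using G by (simp add: Q_def)
qed

text \<open>For m < m' the coefficients at q^(m+1) are 1 and 0, since 1 < q^(m+1) < q^(m'+1). This
  supplies as many distinct nodes as any divided difference requires.\<close>

lemma inj_fps_map_br: "inj (\<lambda>m. fps_map \<rho> (br (1 + \<pi> ^ Suc m)))"
proof (rule linorder_injI)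
  fix m m' :: nat
  assume "m < m'"
  then have "q ^ Suc m < q ^ Suc m'"
    using q_ge_2 by (intro power_strict_increasing) auto
  then have "fps_map \<rho> (br (1 + \<pi> ^ Suc m)) $ (q ^ Suc m)
    \<noteq> fps_map \<rho> (br (1 + \<pi> ^ Suc m')) $ (q ^ Suc m)"
    using q_power_gt_1[of m]
    by (subst (1 2) fps_map_br_one_plus_pi_power_nth) auto
  then show "fps_map \<rho> (br (1 + \<pi> ^ Suc m)) \<noteq> fps_map \<rho> (br (1 + \<pi> ^ Suc m'))" by metis
qed

end

section \<open>Valuation rings, their units and the residue map\<close>

lemma nonarch_abs_one: "nonarch_abs v \<Longrightarrow> v 1 = 1"
  unfolding nonarch_abs_def by (metis mult_cancel_left1 one_neq_zero)

lemma valuation_ring_simps [simp]: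
  "carrier (valuation_ring v F) = {x \<in> F. v x \<le> 1}"
  "x \<otimes>\<^bsub>valuation_ring v F\<^esub> y = x * y"
  "x \<oplus>\<^bsub>valuation_ring v F\<^esub> y = x + y"
  "\<one>\<^bsub>valuation_ring v F\<^esub> = 1"
  "\<zero>\<^bsub>valuation_ring v F\<^esub> = 0"
  by (simp_all add: valuation_ring_def ring_of_type_algebra_def)

lemma subfield_type_algebra_mem:
  fixes F :: "'a::field set"
  assumes "subfield F ring_of_type_algebra"
  shows "1 \<in> F" "0 \<in> F" "x \<in> F \<Longrightarrow> y \<in> F \<Longrightarrow> x + y \<in> F" "x \<in> F \<Longrightarrow> y \<in> F \<Longrightarrow> x * y \<in> F"
    "x \<in> F \<Longrightarrow> inverse x \<in> F"
proof -
  interpret K: field "ring_of_type_algebra :: 'a ring" by rule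
  note F = subringE[OF subfieldE(1)[OF assms]]
  show "1 \<in> F" using F(3) by (simp add: ring_of_type_algebra_def)
  show zero: "0 \<in> F" using F(2) by (simp add: ring_of_type_algebra_def)
  show "x \<in> F \<Longrightarrow> y \<in> F \<Longrightarrow> x + y \<in> F"
    using F(7) by (simp add: ring_of_type_algebra_def)
  show "x \<in> F \<Longrightarrow> y \<in> F \<Longrightarrow> x * y \<in> F"
    using F(6) by (simp add: ring_of_type_algebra_def)
  assume x: "x \<in> F"
  show "inverse x \<in> F"
  proof (cases "x = 0")
    case False
    then have "x \<in> F - {\<zero>\<^bsub>ring_of_type_algebra :: 'a ring\<^esub>}"
      using x by (simp add: ring_of_type_algebra_def)
    from K.subfield_m_inv(1,2)[OF assms this] obtain y where "y \<in> F" "x * y = 1"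
      by (auto simp: ring_of_type_algebra_def)
    then show ?thesis using inverse_unique[of x y] by simp
  qed (use zero in simp)
qed

lemma uniformizer_in_max_ideal:
  assumes "nonarch_abs v" "subfield F ring_of_type_algebra" "is_uniformizer v F \<pi>"
  shows "\<pi> \<in> max_ideal v F"
  using assms nonarch_abs_one[of v] subfield_type_algebra_mem(1)[of F]
  by (auto simp: is_uniformizer_def cgenideal_def intro!: exI[of _ 1])

text \<open>The residue map belongs to the whole field, the uniformizer to \<open>F\<close>. It is
  killed because v \<pi> < 1 places it in the maximal ideal of the large valuation ring.\<close>

lemma lubin_tate_reductionI:
  fixes v :: "'a::field_char_0 \<Rightarrow> real" and \<rho> :: "'a \<Rightarrow> 'k::field"
  assumes v: "nonarch_abs v" and F: "subfield F ring_of_type_algebra"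
    and u: "is_uniformizer v F \<pi>" and r: "is_residue_map v UNIV \<rho>"
    and lt: "lubin_tate_group (carrier (valuation_ring v F)) \<pi> q \<Phi> G br"
  shows "lubin_tate_reduction (carrier (valuation_ring v F)) \<rho> \<pi> q \<Phi> G br"
proof
  have v': "v x \<ge> 0" "v (x * y) = v x * v y" "v (x + y) \<le> max (v x) (v y)" "v 0 = 0" for x y
    using v by (auto simp: nonarch_abs_def)
  have h: "\<rho> \<in> ring_hom (valuation_ring v UNIV) ring_of_type_algebra"
    using r by (simp add: is_residue_map_def)
  note mem = subfield_type_algebra_mem[OF F] 
  let ?R = "carrier (valuation_ring v F)"
  show "0 \<in> ?R" "1 \<in> ?R" using mem v' nonarch_abs_one[OF v] by auto
  show "x + y \<in> ?R" if "x \<in> ?R" "y \<in> ?R" for x y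
    using that mem v'(3)[of x y] by auto
  show "x * y \<in> ?R" if "x \<in> ?R" "y \<in> ?R" for x y
    using that mem v'(1) by (auto simp: v'(2) mult_le_one)
  show "\<rho> 1 = 1" using ring_hom_one[OF h] by (simp add: ring_of_type_algebra_def)
  show "\<rho> (x + y) = \<rho> x + \<rho> y" if "x \<in> ?R" "y \<in> ?R" for x y
    using ring_hom_add[OF h, of x y] that by (simp add: ring_of_type_algebra_def)
  show "\<rho> (x * y) = \<rho> x * \<rho> y" if "x \<in> ?R" "y \<in> ?R" for x y
    using ring_hom_mult[OF h, of x y] that by (simp add: ring_of_type_algebra_def)
  show pi: "\<pi> \<in> ?R" using u by (simp add: is_uniformizer_def)
  have "\<pi> \<in> max_ideal v F" by (rule uniformizer_in_max_ideal[OF v F u])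
  then have "\<pi> \<in> a_kernel (valuation_ring v UNIV) (ring_of_type_algebra :: 'k ring) \<rho>"
    using r by (simp add: is_residue_map_def max_ideal_def)
  then show "\<rho> \<pi> = 0" by (simp add: a_kernel_def' ring_of_type_algebra_def)
  show "lubin_tate_group ?R \<pi> q \<Phi> G br" by (rule lt)
qed

lemma valuation_ring_UnitsI:
  assumes v: "nonarch_abs v" and F: "subfield F ring_of_type_algebra"
    and "x \<in> F" "v x = 1"
  shows "x \<in> Units (valuation_ring v F)"
proof -
  have x: "x \<noteq> 0" using v assms(4) unfolding nonarch_abs_def by (metis zero_neq_one)
  have "v (inverse x) * v x = v 1"
    using v x unfolding nonarch_abs_def by (metis left_inverse)
  then have "v (inverse x) = 1" using assms nonarch_abs_one by simp
  then show ?thesis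
    using assms x subfield_type_algebra_mem(5)[OF F, of x] by (auto simp: Units_def intro!: bexI[of _ "inverse x"])
qed

text \<open>By the ultrametric inequality, adding an element of absolute value below 1 does not
  change the absolute value of 1.\<close>

lemma one_plus_pi_power_Units:
  assumes v: "nonarch_abs v" and F: "subfield F ring_of_type_algebra"
    and "\<pi> \<in> max_ideal v F"
  shows "1 + \<pi> ^ Suc m \<in> Units (valuation_ring v F)"
proof -
  have v': "v x \<ge> 0" "v (x * y) = v x * v y" "v (x + y) \<le> max (v x) (v y)" for x y
    using v by (auto simp: nonarch_abs_def)
  have v1: "v 1 = 1" by (rule nonarch_abs_one[OF v])
  \<comment> \<open>Invariance of \<open>v\<close> under negation is not among the axioms; it
    follows since v (- 1) is a nonnegative square root of 1.\<close>
  have "v (- 1) ^ 2 = 1" using v'(2)[of "-1" "-1"] v1 by (simp add: power2_eq_square)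
  then have vm: "v (- 1) = 1" using v'(1)[of "-1"] by (simp add: power2_eq_1_iff)
  have neg: "v (- x) = v x" for x using v'(2)[of "- 1" x] vm by simp
  have pi: "\<pi> \<in> F" "v \<pi> < 1" using assms(3) by (auto simp: max_ideal_def)
  have p: "\<pi> ^ Suc m \<in> F \<and> v (\<pi> ^ Suc m) < 1"
  proof (induction m)
    case (Suc m)
    then have "v \<pi> * v (\<pi> ^ Suc m) \<le> v \<pi> * 1"
      using v' by (intro mult_left_mono) auto
    then show ?case using Suc pi subfield_type_algebra_mem(4)[OF F]
      by (subst (1 2) power_Suc) (auto simp del: power_Suc simp: v'(2))
  qed (use pi in simp)
  have "v (1 + \<pi> ^ Suc m) \<le> 1" using v'(3)[of 1 "\<pi> ^ Suc m"] p v1 by simp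
  \<comment> \<open>Here 1 is split as (1 + \<pi>^(m+1)) - \<pi>^(m+1); the second summand is too
    small to attain the maximum.\<close>
  moreover have "1 \<le> v (1 + \<pi> ^ Suc m)"
    using v'(3)[of "1 + \<pi> ^ Suc m" "- (\<pi> ^ Suc m)"] p v1 neg[of "\<pi> ^ Suc m"]
    by (simp del: power_Suc add: le_max_iff_disj)
  ultimately show ?thesis
    using p subfield_type_algebra_mem[OF F] by (intro valuation_ring_UnitsI[OF v F]) auto
qed

section \<open>Ideals in the ring of Laurent series\<close>

lemma mv_power_series_nonzeroD:
  assumes "f \<in> mv_power_series D" "f n \<noteq> 0"
  shows "d \<in> D \<Longrightarrow> 0 \<le> n d" "d \<notin> D \<Longrightarrow> n d = 0"
  using assms by (auto simp: mv_power_series_def)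

lemma mv_power_series_subset: "mv_power_series D \<subseteq> carrier (mv_laurent_ring D)"
proof
  fix f :: "('a \<Rightarrow> int) \<Rightarrow> 'b" assume "f \<in> mv_power_series D"
  moreover have "mv_shift D 0 f = f" by (simp add: mv_shift_def cong: if_cong)
  ultimately show "f \<in> carrier (mv_laurent_ring D)"
    unfolding mv_laurent_ring_def mv_laurent_series_def by (auto intro: exI[of _ 0])
qed

definition mv_monom :: "('d \<Rightarrow> int) \<Rightarrow> ('d \<Rightarrow> int) \<Rightarrow> 'k::field" where
  "mv_monom c = (\<lambda>n. if n = c then 1 else 0)"

lemma mv_mult_monom:
  fixes f :: "('d \<Rightarrow> int) \<Rightarrow> 'k::field"
  shows "mv_mult (mv_monom c) f = (\<lambda>n. f (\<lambda>d. n d - c d))"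
proof
  fix n
  have "{a. mv_monom c a \<noteq> (0::'k) \<and> f (\<lambda>d. n d - a d) \<noteq> 0}
      = (if f (\<lambda>d. n d - c d) \<noteq> 0 then {c} else {})"
    by (auto simp: mv_monom_def)
  then show "mv_mult (mv_monom c) f n = f (\<lambda>d. n d - c d)"
    by (simp add: mv_mult_def mv_monom_def)
qed

text \<open>The shift is multiplication by a monomial. It serves to clear the denominators of an
  element of the ideal.\<close>

lemma mv_shift_in_ideal:
  assumes "ideal I (mv_laurent_ring D)" "f \<in> I"
  shows "mv_shift D N f \<in> I"
proof -
  let ?c = "\<lambda>d. if d \<in> D then int N else 0"
  have "mv_shift D N f = mv_mult (mv_monom ?c) f"
    by (auto simp: mv_mult_monom mv_shift_def intro!: ext arg_cong[of _ _ f])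
  moreover have "mv_monom ?c \<in> carrier (mv_laurent_ring D)"
    by (rule subsetD[OF mv_power_series_subset]) (auto simp: mv_power_series_def mv_monom_def)
  ultimately show ?thesis
    using ideal.I_l_closed[OF assms(1) assms(2)] by (simp add: mv_laurent_ring_def)
qed

lemma sum_in_ideal:
  assumes "ideal I (mv_laurent_ring D)" "\<And>j. j \<in> J \<Longrightarrow> F j \<in> I"
  shows "(\<lambda>m. \<Sum>j\<in>J. F j m) \<in> I"
proof -
  note sub = ideal.axioms(1)[OF assms(1)]
  show ?thesis using assms(2)
  proof (induction J rule: infinite_finite_induct)
    case (insert j J)
    then show ?case using additive_subgroup.a_closed[OF sub, of "F j" "\<lambda>m. \<Sum>j\<in>J. F j m"]
      by (simp add: mv_laurent_ring_def)
  qed (use additive_subgroup.zero_closed[OF sub] in \<open>simp_all add: mv_laurent_ring_def\<close>)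
qed

text \<open>The equation h g = 1, read at the exponent \<open>n\<close> and solved for the
  coefficient of h at \<open>n\<close>. The value 0 at all other exponents makes h a power
  series.\<close>

function mv_inverse :: "'d set \<Rightarrow> (('d \<Rightarrow> int) \<Rightarrow> 'k::field) \<Rightarrow> ('d \<Rightarrow> int) \<Rightarrow> 'k" where
  "mv_inverse D g n =
    (if finite D \<and> (\<forall>d\<in>D. 0 \<le> n d) \<and> (\<forall>d. d \<notin> D \<longrightarrow> n d = 0)
     then ((if n = (\<lambda>_. 0) then 1 else 0)
       - (\<Sum>b | b \<noteq> n \<and> (\<forall>d\<in>D. 0 \<le> b d \<and> b d \<le> n d) \<and> (\<forall>d. d \<notin> D \<longrightarrow> b d = 0).
            mv_inverse D g b * g (\<lambda>d. n d - b d))) / g (\<lambda>_. 0)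
     else 0)"
  by pat_completeness auto
termination
proof (relation "measure (\<lambda>(D, g, n). nat (\<Sum>d\<in>D. n d))", goal_cases)
  case (2 D g n b)
  then have b: "\<forall>d\<in>D. 0 \<le> b d \<and> b d \<le> n d" "\<forall>d. d \<notin> D \<longrightarrow> b d = 0" "b \<noteq> n"
    and n: "finite D" "\<forall>d. d \<notin> D \<longrightarrow> n d = 0" by auto
  from b(3) obtain d where d: "b d \<noteq> n d" by (auto simp: fun_eq_iff)
  then have "d \<in> D" using b(2) n(2) by metis
  then have "\<exists>d\<in>D. b d < n d" using b(1) d by (auto intro!: bexI[of _ d] simp: order_less_le)
  \<comment> \<open>The recursion descends in total degree. Finiteness of \<open>D\<close> matters,
    since a sum over an infinite set is 0 by convention.\<close>
  then have "(\<Sum>d\<in>D. b d) < (\<Sum>d\<in>D. n d)"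
    using b(1) n(1) by (intro sum_strict_mono_ex1) auto
  moreover have "0 \<le> (\<Sum>d\<in>D. b d)" using b(1) by (intro sum_nonneg) auto
  ultimately show ?case by simp
qed simp

declare mv_inverse.simps [simp del]

lemma finite_mv_box:
  assumes "finite D"
  shows "finite {b::'d \<Rightarrow> int. (\<forall>d\<in>D. 0 \<le> b d \<and> b d \<le> n d) \<and> (\<forall>d. d \<notin> D \<longrightarrow> b d = 0)}"
proof (rule finite_subset)
  show "finite {b. \<forall>d. (d \<in> D \<longrightarrow> b d \<in> (\<Union>d\<in>D. {0..n d})) \<and> (d \<notin> D \<longrightarrow> b d = 0)}"
    using assms by (intro finite_set_of_finite_funs) auto
qed auto

lemma mv_inverse_mult:
  assumes D: "finite D" and g: "g \<in> mv_power_series D" "g (\<lambda>_. 0) \<noteq> 0"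
  shows "mv_inverse D g \<in> mv_power_series D"
    and "mv_mult (mv_inverse D g) g = (\<lambda>n. if n = (\<lambda>_. 0) then 1 else 0)"
proof -
  let ?h = "mv_inverse D g"
  show h: "?h \<in> mv_power_series D"
  proof -
    have "?h n = 0" if "\<not> ((\<forall>d\<in>D. 0 \<le> n d) \<and> (\<forall>d. d \<notin> D \<longrightarrow> n d = 0))" for n
      by (subst mv_inverse.simps) (use that in auto)
    then show ?thesis unfolding mv_power_series_def by blast
  qed
  show "mv_mult ?h g = (\<lambda>n. if n = (\<lambda>_. 0) then 1 else 0)"
  proof
    fix n
    let ?A = "{a. ?h a \<noteq> 0 \<and> g (\<lambda>d. n d - a d) \<noteq> 0}"
    let ?B = "{b. (\<forall>d\<in>D. 0 \<le> b d \<and> b d \<le> n d) \<and> (\<forall>d. d \<notin> D \<longrightarrow> b d = 0)}"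
    let ?B' = "{b. b \<noteq> n \<and> (\<forall>d\<in>D. 0 \<le> b d \<and> b d \<le> n d) \<and> (\<forall>d. d \<notin> D \<longrightarrow> b d = 0)}"
    \<comment> \<open>Both factors are power series, so the convolution lives on the finite box
      between 0 and \<open>n\<close>.\<close>
    have A: "0 \<le> a d \<and> a d \<le> n d" if "a \<in> ?A" "d \<in> D" for a d
      using that mv_power_series_nonzeroD(1)[OF h, of a d]
        mv_power_series_nonzeroD(1)[OF g(1), of "\<lambda>d. n d - a d" d] by auto
    have A': "a d = 0 \<and> n d = 0" if "a \<in> ?A" "d \<notin> D" for a d
      using that mv_power_series_nonzeroD(2)[OF h, of a d]
        mv_power_series_nonzeroD(2)[OF g(1), of "\<lambda>d. n d - a d" d] by auto
    show "mv_mult ?h g n = (if n = (\<lambda>_. 0) then 1 else 0)"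
    proof (cases "(\<forall>d\<in>D. 0 \<le> n d) \<and> (\<forall>d. d \<notin> D \<longrightarrow> n d = 0)")
      case True
      have "mv_mult ?h g n = (\<Sum>a\<in>?B. ?h a * g (\<lambda>d. n d - a d))"
        unfolding mv_mult_def
      proof (rule sum.mono_neutral_left)
        show "finite ?B" by (rule finite_mv_box[OF D])
        show "?A \<subseteq> ?B"
        proof
          fix a assume a: "a \<in> ?A"
          show "a \<in> ?B" using A[OF a] A'[OF a] by blast
        qed
        show "\<forall>a\<in>?B - ?A. ?h a * g (\<lambda>d. n d - a d) = 0" by auto
      qed
      \<comment> \<open>Splitting off the index \<open>n\<close> isolates the term with the constant
        coefficient of \<open>g\<close>, which the recursion was solved for.\<close>
      also have "?B = insert n ?B'" using True by auto
      also have "(\<Sum>a\<in>insert n ?B'. ?h a * g (\<lambda>d. n d - a d))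
          = ?h n * g (\<lambda>_. 0) + (\<Sum>a\<in>?B'. ?h a * g (\<lambda>d. n d - a d))"
      proof (subst sum.insert)
        show "finite ?B'" by (rule finite_subset[OF _ finite_mv_box[OF D, of n]]) auto
      qed simp_all
      also have "?h n * g (\<lambda>_. 0)
          = (if n = (\<lambda>_. 0) then 1 else 0) - (\<Sum>a\<in>?B'. ?h a * g (\<lambda>d. n d - a d))"
        using True D g(2) by (subst mv_inverse.simps) simp
      finally show ?thesis by simp
    next
      case False
      have "a \<notin> ?A" for a
      proof
        assume a: "a \<in> ?A"
        have "\<forall>d\<in>D. 0 \<le> n d" using A[OF a] by fastforce
        moreover have "\<forall>d. d \<notin> D \<longrightarrow> n d = 0" using A'[OF a] by blast
        ultimately show False using False by blast
      qed
      then have "?A = {}" by blast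
      moreover have "n \<noteq> (\<lambda>_. 0)" using False by auto
      ultimately show ?thesis unfolding mv_mult_def by (simp only: sum.empty if_False)
    qed
  qed
qed

lemma fls_sum_nth: "(\<Sum>j\<in>J. F j) $$ i = (\<Sum>j\<in>J. F j $$ i)"
  by (induction J rule: infinite_finite_induct) auto

lemma ideal_with_unit:
  assumes "ideal I (mv_laurent_ring D)" "finite D"
    and "g \<in> I" "g \<in> mv_power_series D" "g (\<lambda>_. 0) \<noteq> 0"
  shows "I = carrier (mv_laurent_ring D)"
proof (rule ideal.one_imp_carrier[OF assms(1)])
  have "mv_inverse D g \<otimes>\<^bsub>mv_laurent_ring D\<^esub> g \<in> I"
    using assms mv_inverse_mult(1) mv_power_series_subset by (intro ideal.I_l_closed) blast+
  then show "\<one>\<^bsub>mv_laurent_ring D\<^esub> \<in> I"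
    using assms mv_inverse_mult(2)[of D g] by (simp add: mv_laurent_ring_def)
qed

section \<open>Multiplication and substitution in a single variable\<close>

definition mv_of_fls :: "'d \<Rightarrow> 'k::field fls \<Rightarrow> ('d \<Rightarrow> int) \<Rightarrow> 'k" where
  "mv_of_fls d F = (\<lambda>n. if \<forall>e. e \<noteq> d \<longrightarrow> n e = 0 then F $$ n d else 0)"

lemma mv_of_fls_carrier:
  assumes "d \<in> D"
  shows "mv_of_fls d F \<in> carrier (mv_laurent_ring D)"
proof -
  let ?N = "nat (- fls_subdegree F)"
  have "mv_shift D ?N (mv_of_fls d F) \<in> mv_power_series D"
    unfolding mv_power_series_def mem_Collect_eq
  proof (rule allI, rule impI)
    fix n
    assume n: "mv_shift D ?N (mv_of_fls d F) n \<noteq> 0"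
    then have 1: "(if e \<in> D then n e - int ?N else n e) = 0" if "e \<noteq> d" for e
      using that by (auto simp: mv_shift_def mv_of_fls_def split: if_splits)
    from n have "F $$ (n d - int ?N) \<noteq> 0"
      using assms by (auto simp: mv_shift_def mv_of_fls_def split: if_splits)
    then have "n d - int ?N \<ge> fls_subdegree F" by (rule fls_subdegree_leI)
    then have "n d \<ge> 0" by arith
    then show "(\<forall>d\<in>D. 0 \<le> n d) \<and> (\<forall>d. d \<notin> D \<longrightarrow> n d = 0)"
      using 1 assms by (metis diff_eq_eq add_0 of_nat_0_le_iff)
  qed
  then show ?thesis by (auto simp: mv_laurent_ring_def mv_laurent_series_def)
qed

text \<open>The exponents of the other variables are frozen at those of \<open>m\<close>, and the
  value \<open>m d\<close> is ignored. Negative powers of \<open>t\<^sub>d\<close> are dropped, so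
  slices are faithful for power series only.\<close>

definition mv_slice :: "'d \<Rightarrow> ('d \<Rightarrow> int) \<Rightarrow> (('d \<Rightarrow> int) \<Rightarrow> 'k::field) \<Rightarrow> 'k fps" where
  "mv_slice d m f = Abs_fps (\<lambda>i. f (m(d := int i)))"

lemma mv_slice_upd [simp]: "mv_slice d (m(d := i)) f = mv_slice d m f"
  by (simp add: mv_slice_def)

lemma fps_to_fls_mv_slice_nth:
  assumes "f \<in> mv_power_series D" "d \<in> D"
  shows "fps_to_fls (mv_slice d m f) $$ i = f (m(d := i))"
  using mv_power_series_nonzeroD(1)[OF assms(1), of "m(d := i)" d] assms(2)
  by (cases "f (m(d := i)) = 0") (auto simp: mv_slice_def)

lemma mv_slice_nonzeroD:
  assumes "f \<in> mv_power_series D" "mv_slice d m f \<noteq> 0" "e \<noteq> d"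
  shows "e \<in> D \<Longrightarrow> 0 \<le> m e" "e \<notin> D \<Longrightarrow> m e = 0"
proof -
  obtain i where "f (m(d := int i)) \<noteq> 0"
    using assms(2) by (auto simp: mv_slice_def fps_eq_iff)
  then show "e \<in> D \<Longrightarrow> 0 \<le> m e" "e \<notin> D \<Longrightarrow> m e = 0"
    using mv_power_series_nonzeroD[OF assms(1), of "m(d := int i)" e] assms(3) by auto
qed

text \<open>A factor in \<open>t\<^sub>d\<close> alone leaves the other exponents fixed, so it acts
  on every slice by multiplication in one variable.\<close>

lemma mv_mult_of_fls:
  assumes "f \<in> mv_power_series D" "d \<in> D"
  shows "mv_mult (mv_of_fls d F) f m = (F * fps_to_fls (mv_slice d m f)) $$ m d"
proof -
  let ?g = "fps_to_fls (mv_slice d m f)"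
  let ?B = "{i. F $$ i \<noteq> 0 \<and> ?g $$ (m d - i) \<noteq> 0}"
  have upd: "(\<lambda>e. m e - ((\<lambda>_. 0)(d := i)) e) = m(d := m d - i)"
    "(\<lambda>e. m e - (if e = d then i else 0)) = m(d := m d - i)" for i by auto
  have inj: "inj_on (\<lambda>i. (\<lambda>_. 0::int)(d := i)) ?B" by (rule inj_onI) (metis fun_upd_same)
  \<comment> \<open>The contributing exponent vectors are supported at \<open>d\<close>, so their
    entry i there indexes the sum.\<close>
  have "{a. mv_of_fls d F a \<noteq> 0 \<and> f (\<lambda>e. m e - a e) \<noteq> 0} = (\<lambda>i. (\<lambda>_. 0)(d := i)) ` ?B"
  proof (intro equalityI subsetI)
    fix a assume a: "a \<in> {a. mv_of_fls d F a \<noteq> 0 \<and> f (\<lambda>e. m e - a e) \<noteq> 0}"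
    then have eq: "a = (\<lambda>_. 0)(d := a d)" by (auto simp: mv_of_fls_def split: if_splits)
    have "F $$ a d \<noteq> 0" using a by (auto simp: mv_of_fls_def split: if_splits)
    moreover have "(\<lambda>e. m e - a e) = m(d := m d - a d)" by (subst eq) auto
    ultimately show "a \<in> (\<lambda>i. (\<lambda>_. 0)(d := i)) ` ?B"
      using a eq by (auto simp: fps_to_fls_mv_slice_nth[OF assms] simp del: fps_to_fls_nth)
  qed (auto simp: mv_of_fls_def upd fps_to_fls_mv_slice_nth[OF assms] simp del: fps_to_fls_nth)
  then have "mv_mult (mv_of_fls d F) f m = (\<Sum>i\<in>?B. F $$ i * ?g $$ (m d - i))"
    unfolding mv_mult_def
    by (simp only: sum.reindex[OF inj]) (simp add: upd mv_of_fls_def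
        fps_to_fls_mv_slice_nth[OF assms] del: fps_to_fls_nth)
  also have "\<dots> = (\<Sum>i=fls_subdegree F..m d - fls_subdegree ?g. F $$ i * ?g $$ (m d - i))"
    by (rule sum.mono_neutral_left)
      (auto simp del: fps_to_fls_nth dest!: fls_subdegree_leI)
  also have "\<dots> = (F * ?g) $$ m d" by (simp only: fls_times_nth(2))
  finally show ?thesis .
qed

lemma mv_subst_cong:
  assumes "\<And>d. d \<in> D \<Longrightarrow> u d = u' d"
  shows "mv_subst D u = mv_subst D u'"
  using assms by (auto simp: mv_subst_def fun_eq_iff intro!: sum.cong prod.cong)

lemma mv_subst_power_series:
  assumes "f \<in> mv_power_series D"
  shows "mv_subst D u f \<in> mv_power_series D"
  unfolding mv_power_series_def mem_Collect_eq
proof (rule allI, rule impI)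
  fix m
  assume nz: "mv_subst D u f m \<noteq> 0"
  then have "\<forall>d. d \<notin> D \<longrightarrow> m d = 0" by (auto simp: mv_subst_def split: if_splits)
  moreover from nz obtain n where "f n \<noteq> 0" "\<forall>d\<in>D. n d \<le> m d"
    by (auto simp: mv_subst_def split: if_splits elim!: sum.not_neutral_contains_not_neutral)
  ultimately show "(\<forall>d\<in>D. 0 \<le> m d) \<and> (\<forall>d. d \<notin> D \<longrightarrow> m d = 0)"
    using mv_power_series_nonzeroD(1)[OF assms] by (meson order_trans)
qed

text \<open>A variable other than \<open>t\<^sub>d\<close> is replaced by itself, so its factor is 1
  or 0 according to whether the exponents in \<open>n\<close> and \<open>m\<close> agree. What
  survives is the composition of the slice with \<open>u\<close>.\<close>

lemma mv_subst_single:
  assumes D: "finite D" "d \<in> D" and f: "f \<in> mv_power_series D"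
    and m: "\<forall>d. d \<notin> D \<longrightarrow> m d = 0" "m d = int k"
  shows "mv_subst D (\<lambda>e. if e = d then u else fps_X) f m = (mv_slice d m f oo u) $ k"
proof -
  let ?u = "\<lambda>e. if e = d then u else fps_X"
  let ?t = "\<lambda>n. f n * (\<Prod>e\<in>D. fps_to_fls (?u e) powi n e $$ m e)"
  let ?A = "{n. f n \<noteq> 0 \<and> (\<forall>e\<in>D. n e \<le> m e)}"
  let ?B = "{i \<in> {0..k}. f (m(d := int i)) \<noteq> 0}"
  \<comment> \<open>Only nonnegative exponents occur, so the integer powers of Laurent series are
    ordinary powers of power series.\<close>
  have nn: "fps_to_fls (?u e) powi n e $$ m e = (?u e ^ nat (n e)) $ nat (m e)"
    if "n \<in> ?A" "e \<in> D" for n e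
  proof -
    have "0 \<le> n e" using that mv_power_series_nonzeroD(1)[OF f] by blast
    moreover have "n e \<le> m e" using that by blast
    ultimately show ?thesis by (simp add: power_int_def flip: fps_to_fls_power)
  qed
  have A: "finite ?A"
    using mv_power_series_nonzeroD[OF f] by (intro finite_subset[OF _ finite_mv_box[OF D(1), of m]]) blast
  have "mv_subst D ?u f m = (\<Sum>n\<in>?A. ?t n)" using m(1) by (simp add: mv_subst_def)
  also have "\<dots> = (\<Sum>n\<in>(\<lambda>i. m(d := int i)) ` ?B. ?t n)"
  proof (rule sum.mono_neutral_right[OF A])
    show "(\<lambda>i. m(d := int i)) ` ?B \<subseteq> ?A" using m(2) by auto
    show "\<forall>n\<in>?A - (\<lambda>i. m(d := int i)) ` ?B. ?t n = 0"
    proof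
      fix n assume n: "n \<in> ?A - (\<lambda>i. m(d := int i)) ` ?B"
      have "\<exists>e\<in>D - {d}. n e \<noteq> m e"
      proof (rule ccontr)
        assume "\<not> (\<exists>e\<in>D - {d}. n e \<noteq> m e)"
        moreover have "n e = m e" if "e \<notin> D" for e
          using that m(1) n mv_power_series_nonzeroD(2)[OF f, of n e] by auto
        moreover have "0 \<le> n d" using n D(2) mv_power_series_nonzeroD(1)[OF f] by blast
        ultimately have "n = m(d := int (nat (n d)))" by (auto simp: fun_eq_iff)
        moreover have "nat (n d) \<le> k" using n D(2) m(2) by fastforce
        ultimately have "n \<in> (\<lambda>i. m(d := int i)) ` ?B" using n
          by (intro image_eqI[of _ _ "nat (n d)"]) auto
        then show False using n by blast
      qed
      then obtain e where e: "e \<in> D" "e \<noteq> d" "n e \<noteq> m e" by blast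
      have "0 \<le> n e" "n e \<le> m e" using n e(1) mv_power_series_nonzeroD(1)[OF f] by blast+
      then have "fps_to_fls (?u e) powi n e $$ m e = 0"
        using nn[of n e] n e by (simp add: fps_X_power_nth)
      then have "(\<Prod>e\<in>D. fps_to_fls (?u e) powi n e $$ m e) = 0"
        using D(1) e(1) by (intro prod_zero) blast+
      then show "?t n = 0" by (simp only: mult_zero_right)
    qed
  qed
  also have "\<dots> = (\<Sum>i\<in>?B. ?t (m(d := int i)))"
  proof (subst sum.reindex)
    show "inj_on (\<lambda>i. m(d := int i)) ?B" by (rule inj_onI) (metis fun_upd_same of_nat_eq_iff)
  qed simp
  also have "\<dots> = (\<Sum>i\<in>?B. f (m(d := int i)) * (u ^ i) $ k)"
  proof (rule sum.cong[OF refl])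
    fix i assume i: "i \<in> ?B"
    let ?n = "m(d := int i)"
    have n: "?n \<in> ?A" using i m(2) by auto
    have "(\<Prod>e\<in>D. fps_to_fls (?u e) powi ?n e $$ m e)
        = (\<Prod>e\<in>D. (?u e ^ nat (?n e)) $ nat (m e))"
      using nn[OF n] by (intro prod.cong) auto
    also have "\<dots> = (u ^ i) $ k * (\<Prod>e\<in>D - {d}. (?u e ^ nat (?n e)) $ nat (m e))"
      using D m(2) by (subst prod.remove) auto
    also have "(\<Prod>e\<in>D - {d}. (?u e ^ nat (?n e)) $ nat (m e)) = 1"
      by (intro prod.neutral) (auto simp: fps_X_power_nth)
    finally show "?t ?n = f ?n * (u ^ i) $ k" by simp
  qed
  also have "\<dots> = (\<Sum>i=0..k. f (m(d := int i)) * (u ^ i) $ k)"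
    by (rule sum.mono_neutral_left) auto
  also have "\<dots> = (mv_slice d m f oo u) $ k"
    by (simp add: fps_compose_nth mv_slice_def)
  finally show ?thesis .
qed

lemma mv_slice_subst_single:
  assumes D: "finite D" "d \<in> D" and f: "f \<in> mv_power_series D"
  shows "mv_slice d m (mv_subst D (\<lambda>e. if e = d then u else fps_X) f) = mv_slice d m f oo u"
proof (cases "\<forall>e. e \<notin> D \<longrightarrow> m e = 0")
  case True
  show ?thesis
  proof (rule fps_ext)
    fix k
    show "mv_slice d m (mv_subst D (\<lambda>e. if e = d then u else fps_X) f) $ k
      = (mv_slice d m f oo u) $ k"
      using mv_subst_single[OF D f, of "m(d := int k)" k u] True D(2)
      by (auto simp: mv_slice_def[of d m "mv_subst D u f" for u])
  qed
next
  case False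
  then obtain e where "e \<notin> D" "m e \<noteq> 0" by blast
  \<comment> \<open>An exponent that is nonzero outside \<open>D\<close> does not occur in a power
    series, so both sides of the claim are 0.\<close>
  then have "mv_slice d m h = 0" if "h \<in> mv_power_series D" for h :: "('a \<Rightarrow> int) \<Rightarrow> 'b"
    using mv_slice_nonzeroD(2)[OF that, of d m e] D(2) by blast
  then show ?thesis using f mv_subst_power_series[OF f] by simp
qed

text \<open>The divided difference in \<open>t\<^sub>d\<close> at the nodes U_0, ..., U_a. It
  preserves the ideal by stability, its weights being Laurent series in \<open>t\<^sub>d\<close>,
  and on slices it is computed by \<open>dd_compose\<close>.\<close>

lemma ideal_extract_coeff:
  fixes I :: "(('d \<Rightarrow> int) \<Rightarrow> 'k::field) set" and U :: "nat \<Rightarrow> 'k fps"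
  assumes I: "ideal I (mv_laurent_ring D)" and D: "finite D" "d \<in> D"
    and U: "inj U" "\<And>j. U j $ 0 = 0"
    and st: "\<And>j f. f \<in> I \<Longrightarrow> mv_subst D (\<lambda>e. if e = d then U j else fps_X) f \<in> I"
    and f: "f \<in> I" "f \<in> mv_power_series D"
  obtains g where "g \<in> I" "g \<in> mv_power_series D" "\<And>m. m d = 0 \<Longrightarrow> g m = f (m(d := int a))"
proof -
  \<comment> \<open>The index set has a + 1 elements, the number of nodes that singles out the
    coefficient of \<open>t\<^sub>d\<close> to the power \<open>a\<close>.\<close>
  define w where "w = dd_weight (\<lambda>j::nat. fps_to_fls (U j)) {..a}"
  define s where "s j = mv_subst D (\<lambda>e. if e = d then U j else fps_X) f" for j
  define g where "g m = (\<Sum>j\<le>a. mv_mult (mv_of_fls d (w j)) (s j) m)" for m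
  have "mv_mult (mv_of_fls d (w j)) (s j) \<in> I" for j
    using ideal.I_l_closed[OF I st[OF f(1), of j] mv_of_fls_carrier[OF D(2), of "w j"]]
    by (simp add: s_def mv_laurent_ring_def)
  then have gI: "g \<in> I" unfolding g_def by (intro sum_in_ideal[OF I])
  have g: "g m = (\<Sum>j\<le>a. w j * fps_to_fls (mv_slice d m f oo U j)) $$ m d" for m
    using mv_mult_of_fls[OF mv_subst_power_series[OF f(2)] D(2)]
    by (simp add: g_def s_def fls_sum_nth mv_slice_subst_single[OF D f(2)])
  have c: "fls_has_const (\<Sum>j\<le>a. w j * fps_to_fls (mv_slice d m f oo U j)) (mv_slice d m f $ a)"
    for m
    unfolding w_def using U by (intro dd_compose) (auto intro: inj_on_subset)
  show ?thesis
  proof (rule that[OF gI])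
    show "g m = f (m(d := int a))" if "m d = 0" for m
      using c[of m] that by (auto simp: g fls_has_const_def mv_slice_def)
    show "g \<in> mv_power_series D"
      unfolding mv_power_series_def mem_Collect_eq
    proof (rule allI, rule impI)
      fix m assume m: "g m \<noteq> 0"
      then have "mv_slice d m f \<noteq> 0" by (auto simp: g)
      \<comment> \<open>The poles of the individual summands cancel: by \<open>dd_compose\<close>
        the slice of \<open>g\<close> is regular.\<close>
      moreover have "0 \<le> m d" using m c[of m] by (auto simp: g fls_has_const_def split: if_splits)
      ultimately show "(\<forall>e\<in>D. 0 \<le> m e) \<and> (\<forall>e. e \<notin> D \<longrightarrow> m e = 0)"
        using mv_slice_nonzeroD[OF f(2)] D(2) by metis
    qed
  qed
qed

text \<open>A nonzero coefficient is moved to the exponent 0, one variable at a time. The set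
  \<open>E\<close> in the induction collects the variables already treated.\<close>

lemma mv_ideal_trivial:
  fixes I :: "(('d \<Rightarrow> int) \<Rightarrow> 'k::field) set" and U :: "nat \<Rightarrow> 'k fps"
  assumes I: "ideal I (mv_laurent_ring D)" and D: "finite D"
    and U: "inj U" "\<And>j. U j $ 0 = 0"
    and st: "\<And>d j f. d \<in> D \<Longrightarrow> f \<in> I \<Longrightarrow> mv_subst D (\<lambda>e. if e = d then U j else fps_X) f \<in> I"
  shows "I = {\<zero>\<^bsub>mv_laurent_ring D\<^esub>} \<or> I = carrier (mv_laurent_ring D)"
proof (cases "I = {\<zero>\<^bsub>mv_laurent_ring D\<^esub>}")
  case False
  moreover have "\<zero>\<^bsub>mv_laurent_ring D\<^esub> \<in> I"
    using I by (simp add: additive_subgroup.zero_closed ideal.axioms(1))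
  ultimately obtain f where f: "f \<in> I" "f \<noteq> (\<lambda>_. 0)" by (auto simp: mv_laurent_ring_def)
  then obtain a where a: "f a \<noteq> 0" by auto
  have "f \<in> carrier (mv_laurent_ring D)" using ideal.Icarr[OF I f(1)] .
  then obtain N where N: "mv_shift D N f \<in> mv_power_series D"
    by (auto simp: mv_laurent_ring_def mv_laurent_series_def)
  have "\<exists>g\<in>I \<inter> mv_power_series D. \<exists>b. g b \<noteq> 0 \<and> (\<forall>e\<in>E. b e = 0)" if "E \<subseteq> D" for E
    using finite_subset[OF that D] that
  proof (induction E rule: finite_induct)
    case empty
    \<comment> \<open>Clearing denominators carries the nonzero coefficient of \<open>f\<close>
      along to a shifted exponent.\<close>
    have "mv_shift D N f (\<lambda>d. if d \<in> D then a d + int N else a d) = f a"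
      by (auto simp: mv_shift_def intro!: arg_cong[of _ _ f])
    then show ?case using a N mv_shift_in_ideal[OF I f(1)] by (metis IntI empty_iff)
  next
    case (insert d E)
    then obtain g b where g: "g \<in> I" "g \<in> mv_power_series D" "g b \<noteq> 0" "\<forall>e\<in>E. b e = 0"
      by auto
    have d: "d \<in> D" using insert by simp
    \<comment> \<open>The power of \<open>t\<^sub>d\<close> to extract is the one occurring in
      \<open>b\<close>. The coefficient of \<open>g\<close> at \<open>b\<close> then reappears in
      \<open>h\<close> with the exponent of \<open>t\<^sub>d\<close> set to 0, and the zeros on
      \<open>E\<close> persist.\<close>
    obtain h where h: "h \<in> I" "h \<in> mv_power_series D"
      "\<And>m. m d = 0 \<Longrightarrow> h m = g (m(d := int (nat (b d))))"
      using ideal_extract_coeff[OF I D d U st[OF d] g(1,2)] by blast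
    have "0 \<le> b d" using mv_power_series_nonzeroD(1)[OF g(2,3) d] .
    then have "h (b(d := 0)) = g b" using h(3)[of "b(d := 0)"] by simp
    then have "h (b(d := 0)) \<noteq> 0" using g(3) by simp
    moreover have "\<forall>e\<in>insert d E. (b(d := 0)) e = 0" using g(4) by simp
    ultimately show ?case using h(1,2) by blast
  qed
  then obtain g b where g: "g \<in> I" "g \<in> mv_power_series D" "g b \<noteq> 0" "\<forall>e\<in>D. b e = 0" by blast
  have "b = (\<lambda>_. 0)"
    using g(4) mv_power_series_nonzeroD(2)[OF g(2,3)] by (metis ext)
  then have "I = carrier (mv_laurent_ring D)" using ideal_with_unit[OF I D g(1,2)] g(3) by simp
  then show ?thesis ..
qed simp

theorem theorem1:
  fixes p :: nat
    and v :: "'a::field_char_0 \<Rightarrow> real"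
    and Qp F :: "'a set"
    and \<pi> :: 'a
    and \<rho> :: "'a \<Rightarrow> 'k::field"
    and \<Phi> :: "'a fps"
    and G :: "'a fps fps"
    and br :: "'a \<Rightarrow> 'a fps"
    and D :: "'d set"
    and I :: "(('d \<Rightarrow> int) \<Rightarrow> 'k) set"
  assumes "Factorial_Ring.prime p"
    and "nonarch_abs v"
    and "is_padic_numbers p v Qp"
    and "ring.finite_dimension ring_of_type_algebra Qp (UNIV :: 'a set)"
    and "subfield F ring_of_type_algebra" and "Qp \<subseteq> F"
    and "is_uniformizer v F \<pi>"
    and "is_residue_map v UNIV \<rho>"
    and "lubin_tate_group (carrier (valuation_ring v F)) \<pi> (residue_card v F) \<Phi> G br"
    and "finite D"
    and "ideal I (mv_laurent_ring D)"
    and "\<And>\<gamma> f. \<gamma> \<in> (\<Pi>\<^sub>E d\<in>D. Units (valuation_ring v F)) \<Longrightarrow> f \<in> I \<Longrightarrow> lt_action \<rho> br D \<gamma> f \<in> I"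
  shows "I = {\<zero>\<^bsub>mv_laurent_ring D\<^esub>} \<or> I = carrier (mv_laurent_ring D)"
proof -
  let ?R = "carrier (valuation_ring v F)"
  interpret L: lubin_tate_reduction ?R \<rho> \<pi> "residue_card v F" \<Phi> G br
    by (rule lubin_tate_reductionI[OF assms(2,5,7,8,9)])
  define \<gamma> where "\<gamma> j = 1 + \<pi> ^ Suc j" for j
  define U where "U j = fps_map \<rho> (br (\<gamma> j))" for j
  have \<gamma>_unit: "\<gamma> j \<in> Units (valuation_ring v F)" for j
    unfolding \<gamma>_def
    by (rule one_plus_pi_power_Units[OF assms(2,5) uniformizer_in_max_ideal[OF assms(2,5,7)]])
  have one_unit: "1 \<in> Units (valuation_ring v F)"
    by (rule valuation_ring_UnitsI[OF assms(2,5) subfield_type_algebra_mem(1)[OF assms(5)]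
          nonarch_abs_one[OF assms(2)]])
  show ?thesis
  proof (rule mv_ideal_trivial[OF assms(11,10)])
    show "inj U" using L.inj_fps_map_br by (simp only: U_def[abs_def] \<gamma>_def)
    have "\<gamma> j \<in> ?R" for j
      unfolding \<gamma>_def by (intro L.add_mem L.one_mem L.power_mem L.pi_mem)
    then show "U j $ 0 = 0" for j
      by (simp only: U_def fps_map_nth L.br_nth_0 L.hom_zero)
  next
    fix d j f
    assume "d \<in> D" "f \<in> I"
    \<comment> \<open>The unit acts in the component \<open>d\<close> alone; elsewhere the scalar 1
      acts as the identity substitution.\<close>
    define g where "g = (\<lambda>e\<in>D. if e = d then \<gamma> j else 1)"
    have "g \<in> (\<Pi>\<^sub>E d\<in>D. Units (valuation_ring v F))"
      using \<gamma>_unit one_unit by (auto simp: g_def)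
    then have "lt_action \<rho> br D g f \<in> I" using \<open>f \<in> I\<close> by (rule assms(12))
    \<comment> \<open>Off \<open>D\<close> the restricted function \<open>g\<close> has an
      unspecified value, but a substitution looks only at the series indexed by
      \<open>D\<close>.\<close>
    moreover have "lt_action \<rho> br D g = mv_subst D (\<lambda>e. if e = d then U j else fps_X)"
      unfolding lt_action_def fps_map_def[symmetric]
      by (rule mv_subst_cong) (simp add: g_def U_def L.br_one)
    ultimately show "mv_subst D (\<lambda>e. if e = d then U j else fps_X) f \<in> I" by simp
  qed
qed

end
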